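(* Let $q$ be a power of $2$, so that $\mathbf{F}_q$ has characteristic two, and for $n\geq 1$ let $a_n$ be the number of $n \times n$ matrices $A$ over $\mathbf{F}_q$ satisfying $A^2=I$. Then $$a_n = \sum_{0 \leq i \leq n/2} \frac{\gamma_n}{q^{i(2n-3i)}\,\gamma_{i}\, \gamma_{n-2i} } ,$$ where the sum is over integers $i$ with $0\leq i\leq n/2$.
   Context: $\mathbf{F}_q$ is the field with $q$ elements. $\gamma_n=|\mathrm{GL}_n(q)|=(q^n-1)(q^n-q)\cdots(q^n-q^{n-1})$ is the order of the group of invertible $n\times n$ matrices over $\mathbf{F}_q$, with $\gamma_0=1$. $I$ is the identity matrix. *)

theory Defs
  imports "Jordan_Normal_Form.Matrix" "HOL-Algebra.Coset"
begin

definition general_linear_group :: "'a::comm_ring_1 itself \<Rightarrow> nat \<Rightarrow> 'a mat monoid" where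
  "general_linear_group ty n = units_of (ring_mat ty n ())"

definition GL_order :: "'a::comm_ring_1 itself \<Rightarrow> nat \<Rightarrow> nat" where
  "GL_order ty n = order (general_linear_group ty n)"

lemma group_general_linear_group: "group (general_linear_group TYPE('a::comm_ring_1) n)"
proof -
  interpret ring "ring_mat TYPE('a) n ()" by (rule ring_mat)
  show ?thesis unfolding general_linear_group_def by (rule units_group)
qed

lemma carrier_general_linear_group:
  "carrier (general_linear_group TYPE('a::comm_ring_1) n) =
     {A \<in> carrier_mat n n. \<exists>B \<in> carrier_mat n n. B * A = 1\<^sub>m n \<and> A * B = 1\<^sub>m n}"
  by (simp add: general_linear_group_def units_of_def Units_def ring_mat_simps)

lemma GL_order_0: "GL_order TYPE('a::comm_ring_1) 0 = 1"
proof -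
  have "carrier (general_linear_group TYPE('a) 0) = {1\<^sub>m 0}"
    unfolding carrier_general_linear_group by (auto intro!: eq_matI)
  then show ?thesis by (simp add: GL_order_def order_def)
qed

end

theory Submission
  imports Defs "Jordan_Normal_Form.Determinant"
begin

text \<open>
  In characteristic two, \<open>(1 + N)\<^sup>2 = 1 + N\<^sup>2\<close>, so \<open>A \<mapsto> A + 1\<close> exchanges the solutions of
  \<open>A\<^sup>2 = 1\<close> with the matrices \<open>N\<close> of square zero, and it suffices to count the latter
  (\<open>card_involutory_eq_card_square_zero\<close>).

  A matrix with \<open>N\<^sup>2 = 0\<close> and rank \<open>i\<close> has Jordan blocks of size at most two, exactly \<open>i\<close> of
  them of size two. It is therefore similar to one fixed matrix \<open>square_zero_nf i m\<close>, where
  \<open>n = 2 i + m\<close> (\<open>square_zero_similar_nf\<close>), and different \<open>i\<close> give different classes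
  (\<open>similar_square_zero_nf_le\<close>). The normal form is reached without Jordan theory: write
  \<open>N = P E Q\<close> with \<open>E\<close> the rank normal form of \<open>N\<close>, pass to the similar matrix \<open>E Q P\<close>, whose
  lower rows vanish, and apply the rank normal form once more to its only nonzero block.

  By orbit counting, a similarity class has size \<open>\<gamma>\<^sub>n\<close> divided by the order of the group of
  invertible matrices commuting with its representative (\<open>card_similarity_class\<close>). For
  \<open>square_zero_nf i m\<close> these are the block triangular matrices determined by a diagonal block
  in \<open>GL\<^sub>i\<close>, occurring twice, another one in \<open>GL\<^sub>m\<close>, and \<open>i (i + m) + m i = i (2 n - 3 i)\<close>
  arbitrary entries (\<open>card_centralizer_square_zero_nf\<close>). Summing over \<open>i\<close> gives the formula.
\<close>

section \<open>Products, blocks and inverses of matrices\<close>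

lemma index_mult_mat_sum:
  assumes "A \<in> carrier_mat a b" "B \<in> carrier_mat b c" "i < a" "j < c"
  shows "(A * B) $$ (i,j) = (\<Sum>k<b. A $$ (i,k) * B $$ (k,j))"
  using assms by (auto simp: scalar_prod_def atLeast0LessThan intro!: sum.cong)

text \<open>
  Conditions on dimensions, in contrast to membership in \<open>carrier_mat\<close>, leave no variable for
  the simplifier to guess when it re-associates products of rectangular matrices.
\<close>

lemma mult_mat_assoc:
  fixes A B C :: "'a::semiring_0 mat"
  assumes "dim_col A = dim_row B" "dim_col B = dim_row C"
  shows "A * B * C = A * (B * C)"
  using assms by (intro assoc_mult_mat[of _ "dim_row A" "dim_col A" _ "dim_col B" _ "dim_col C"]) auto

lemma four_block_mat_eqD:
  assumes eq: "four_block_mat A B C D = four_block_mat A' B' C' D'"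
    and c: "A \<in> carrier_mat a b" "B \<in> carrier_mat a d" "C \<in> carrier_mat c b" "D \<in> carrier_mat c d"
    and c': "A' \<in> carrier_mat a b" "B' \<in> carrier_mat a d" "C' \<in> carrier_mat c b" "D' \<in> carrier_mat c d"
  shows "A = A'" "B = B'" "C = C'" "D = D'"
proof -
  have e: "four_block_mat A B C D $$ (i,j) = four_block_mat A' B' C' D' $$ (i,j)" for i j
    using eq by simp
  show "A = A'"
  proof (rule eq_matI)
    fix i j assume "i < dim_row A'" "j < dim_col A'"
    then show "A $$ (i,j) = A' $$ (i,j)" using e[of i j] c c' by auto
  qed (use c c' in auto)
  show "B = B'"
  proof (rule eq_matI)
    fix i j assume "i < dim_row B'" "j < dim_col B'"
    then show "B $$ (i,j) = B' $$ (i,j)" using e[of i "b + j"] c c' by auto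
  qed (use c c' in auto)
  show "C = C'"
  proof (rule eq_matI)
    fix i j assume "i < dim_row C'" "j < dim_col C'"
    then show "C $$ (i,j) = C' $$ (i,j)" using e[of "a + i" j] c c' by auto
  qed (use c c' in auto)
  show "D = D'"
  proof (rule eq_matI)
    fix i j assume "i < dim_row D'" "j < dim_col D'"
    then show "D $$ (i,j) = D' $$ (i,j)" using e[of "a + i" "b + j"] c c' by auto
  qed (use c c' in auto)
qed

lemma mat_split_blocks:
  assumes "A \<in> carrier_mat (a + c) (b + d)"
  obtains A1 A2 A3 A4 where "A1 \<in> carrier_mat a b" "A2 \<in> carrier_mat a d"
    "A3 \<in> carrier_mat c b" "A4 \<in> carrier_mat c d" "A = four_block_mat A1 A2 A3 A4"
proof -
  obtain A1 A2 A3 A4 where "split_block A a b = (A1, A2, A3, A4)"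
    by (cases "split_block A a b") auto
  from split_block[OF this, of c d] assms that show thesis by auto
qed

lemma obtain_inverse_mat:
  fixes P :: "'a::field mat"
  assumes "P \<in> carrier_mat n n" "det P \<noteq> 0"
  obtains Q where "Q \<in> carrier_mat n n" "P * Q = 1\<^sub>m n" "Q * P = 1\<^sub>m n" "det Q \<noteq> 0"
proof -
  from det_non_zero_imp_unit[OF assms, of "()"]
  obtain Q where Q: "Q \<in> carrier_mat n n" "P * Q = 1\<^sub>m n" "Q * P = 1\<^sub>m n"
    by (auto simp: Units_def ring_mat_simps)
  from det_mult[OF assms(1) Q(1)] Q(2) have "det Q \<noteq> 0" by auto
  with Q that show thesis by blast
qed

text \<open>
  Determinants turn invertibility into an equation, which for block triangular matrices reduces
  to the diagonal blocks.
\<close>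

lemma GL_order_eq_card_det:
  "GL_order TYPE('a::field) n = card {P :: 'a mat. P \<in> carrier_mat n n \<and> det P \<noteq> 0}"
proof -
  have "carrier (general_linear_group TYPE('a) n) = {P. P \<in> carrier_mat n n \<and> det P \<noteq> 0}"
  proof (intro equalityI subsetI)
    fix P :: "'a mat"
    assume "P \<in> carrier (general_linear_group TYPE('a) n)"
    then obtain Q where "P \<in> carrier_mat n n" "Q \<in> carrier_mat n n" "P * Q = 1\<^sub>m n"
      by (auto simp: carrier_general_linear_group)
    with det_mult[of P n Q] show "P \<in> {P. P \<in> carrier_mat n n \<and> det P \<noteq> 0}" by auto
  next
    fix P :: "'a mat"
    assume P: "P \<in> {P. P \<in> carrier_mat n n \<and> det P \<noteq> 0}"
    then obtain Q where "Q \<in> carrier_mat n n" "P * Q = 1\<^sub>m n" "Q * P = 1\<^sub>m n"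
      using obtain_inverse_mat[of P n] by auto
    with P show "P \<in> carrier (general_linear_group TYPE('a) n)"
      by (auto simp: carrier_general_linear_group)
  qed
  then show ?thesis by (simp add: GL_order_def Coset.order_def)
qed

lemma card_carrier_mat:
  "card (carrier_mat a b :: 'a::finite mat set) = card (UNIV :: 'a set) ^ (a * b)"
  and finite_carrier_mat: "finite (carrier_mat a b :: 'a::finite mat set)"
proof -
  let ?I = "{..<a} \<times> {..<b}"
  have "bij_betw (mat a b) (?I \<rightarrow>\<^sub>E (UNIV :: 'a set)) (carrier_mat a b)"
    by (rule bij_betw_byWitness[where f' = "\<lambda>M. restrict (\<lambda>ij. M $$ ij) ?I"])
      (auto simp: fun_eq_iff PiE_def extensional_def intro!: eq_matI)
  moreover have "finite (?I \<rightarrow>\<^sub>E (UNIV :: 'a set))" by (intro finite_PiE) auto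
  ultimately show "card (carrier_mat a b :: 'a mat set) = card (UNIV :: 'a set) ^ (a * b)"
    "finite (carrier_mat a b :: 'a mat set)"
    using bij_betw_same_card bij_betw_finite by (fastforce simp: card_PiE card_cartesian_product)+
qed

section \<open>Sizes of similarity classes\<close>

text \<open>
  Similarity without naming the inverse of the transforming matrix, so that it can be checked by
  multiplying block matrices.
\<close>

lemma similar_mat_iff_intertwined:
  fixes A B :: "'a::field mat"
  assumes A: "A \<in> carrier_mat n n" and B: "B \<in> carrier_mat n n"
  shows "similar_mat A B \<longleftrightarrow> (\<exists>P \<in> carrier_mat n n. det P \<noteq> 0 \<and> A * P = P * B)"
proof
  assume "similar_mat A B"
  then obtain P Q where PQ: "P \<in> carrier_mat n n" "Q \<in> carrier_mat n n"
    "P * Q = 1\<^sub>m n" "Q * P = 1\<^sub>m n" "A = P * B * Q"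
    using A by (auto simp: similar_mat_def similar_mat_wit_def Let_def)
  from det_mult[OF PQ(1,2)] PQ(3) have "det P \<noteq> 0" by auto
  moreover have "A * P = P * B"
    using PQ B by (simp add: assoc_mult_mat[of _ n n _ n _ n])
  ultimately show "\<exists>P \<in> carrier_mat n n. det P \<noteq> 0 \<and> A * P = P * B" using PQ by blast
next
  assume "\<exists>P \<in> carrier_mat n n. det P \<noteq> 0 \<and> A * P = P * B"
  then obtain P where P: "P \<in> carrier_mat n n" "det P \<noteq> 0" "A * P = P * B" by blast
  then obtain Q where Q: "Q \<in> carrier_mat n n" "P * Q = 1\<^sub>m n" "Q * P = 1\<^sub>m n"
    using obtain_inverse_mat[OF P(1,2)] by blast
  have "A = P * B * Q" unfolding P(3)[symmetric]
    using A P(1) Q by (simp add: assoc_mult_mat[of _ n n _ n _ n])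
  with A B P Q show "similar_mat A B" by (intro similar_matI[of _ _ P Q n]) auto
qed

text \<open>
  Orbit-stabilizer for conjugation. The sets \<open>F N\<close> of invertible \<open>P\<close> with \<open>N P = P J\<close>, that is
  \<open>N = P J P\<^sup>-\<^sup>1\<close>, partition the general linear group as \<open>N\<close> runs through the class of \<open>J\<close>, and
  each of them is a left coset of the centralizer of \<open>J\<close>.
\<close>

lemma card_similarity_class:
  fixes J :: "'a::{field, finite} mat"
  assumes J: "J \<in> carrier_mat n n"
  shows "card {N \<in> carrier_mat n n. similar_mat N J} *
      card {S \<in> carrier_mat n n. det S \<noteq> 0 \<and> S * J = J * S} = GL_order TYPE('a) n"
proof -
  let ?O = "{N \<in> carrier_mat n n. similar_mat N J}"
  let ?C = "{S \<in> carrier_mat n n. det S \<noteq> 0 \<and> S * J = J * S}"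
  define F where "F N = {P \<in> carrier_mat n n. det P \<noteq> 0 \<and> N * P = P * J}" for N
  have finF: "finite (F N)" for N
    unfolding F_def by (rule finite_subset[OF _ finite_carrier_mat[of n n]]) auto
  have finO: "finite ?O" by (rule finite_subset[OF _ finite_carrier_mat[of n n]]) auto
  have "card (F N) = card ?C" if N: "N \<in> ?O" for N
  proof -
    from N have Nc: "N \<in> carrier_mat n n" by simp
    from N obtain P where P: "P \<in> carrier_mat n n" "det P \<noteq> 0" "N * P = P * J"
      using similar_mat_iff_intertwined[OF Nc J] by auto
    then obtain Q where Q: "Q \<in> carrier_mat n n" "P * Q = 1\<^sub>m n" "Q * P = 1\<^sub>m n" "det Q \<noteq> 0"
      using obtain_inverse_mat[OF P(1,2)] by blast
    note assoc = assoc_mult_mat[of _ n n _ n _ n]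
    have NPJ: "P * J * Q = N" unfolding P(3)[symmetric] using Nc P(1) Q by (simp add: assoc)
    have "Q * N = Q * (P * (J * Q))" unfolding NPJ[symmetric]
      using J P(1) Q(1) by (simp add: assoc)
    also have "\<dots> = (Q * P) * (J * Q)" using J P(1) Q(1) by (simp add: assoc)
    finally have QN: "Q * N = J * Q" using J Q by simp
    have "bij_betw ((*) P) ?C (F N)"
    proof (rule bij_betw_byWitness[where f' = "(*) Q"])
      show "\<forall>S\<in>?C. Q * (P * S) = S"
        using P(1) Q by (auto simp: assoc[symmetric])
      show "\<forall>S\<in>F N. P * (Q * S) = S"
        using P(1) Q by (auto simp: assoc[symmetric] F_def)
      show "(*) P ` ?C \<subseteq> F N"
      proof clarify
        fix S assume S: "S \<in> carrier_mat n n" "det S \<noteq> 0" "S * J = J * S"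
        have "N * (P * S) = (N * P) * S" using Nc P(1) S by (simp add: assoc)
        also have "\<dots> = P * (J * S)" unfolding P(3) using P(1) S J by (simp add: assoc)
        also have "\<dots> = P * S * J" unfolding S(3)[symmetric] using P S J by (simp add: assoc)
        finally show "P * S \<in> F N" using P S by (simp add: F_def det_mult)
      qed
      show "(*) Q ` F N \<subseteq> ?C"
      proof clarify
        fix S assume "S \<in> F N"
        then have S: "S \<in> carrier_mat n n" "det S \<noteq> 0" "N * S = S * J" by (auto simp: F_def)
        have "Q * S * J = Q * (N * S)" unfolding S(3) using Q S J by (simp add: assoc)
        also have "\<dots> = (Q * N) * S" using Nc Q S by (simp add: assoc)
        also have "\<dots> = J * (Q * S)" unfolding QN using Q S J by (simp add: assoc)
        finally show "Q * S \<in> carrier_mat n n \<and> det (Q * S) \<noteq> 0 \<and> Q * S * J = J * (Q * S)"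
          using Q S by (simp add: det_mult)
      qed
    qed
    then show ?thesis by (rule bij_betw_same_card[symmetric])
  qed
  then have "card ?O * card ?C = (\<Sum>N\<in>?O. card (F N))" by simp
  also have "\<dots> = card (\<Union>N\<in>?O. F N)"
  proof (rule card_UN_disjoint[symmetric, OF finO])
    show "\<forall>N\<in>?O. finite (F N)" using finF by blast
    show "\<forall>N\<in>?O. \<forall>N'\<in>?O. N \<noteq> N' \<longrightarrow> F N \<inter> F N' = {}"
    proof (intro ballI impI, rule ccontr)
      fix N N' assume N: "N \<in> ?O" "N' \<in> ?O" "N \<noteq> N'" "F N \<inter> F N' \<noteq> {}"
      then obtain P where "P \<in> F N" "P \<in> F N'" by blast
      then have P: "P \<in> carrier_mat n n" "det P \<noteq> 0" "N * P = N' * P"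
        by (simp_all add: F_def)
      then obtain Q where Q: "Q \<in> carrier_mat n n" "P * Q = 1\<^sub>m n"
        using obtain_inverse_mat[OF P(1,2)] by blast
      from N have c: "N \<in> carrier_mat n n" "N' \<in> carrier_mat n n" by auto
      have "N = N * P * Q" using c P(1) Q by (simp add: assoc_mult_mat[of _ n n _ n _ n])
      also have "\<dots> = N'" unfolding P(3) using c P(1) Q by (simp add: assoc_mult_mat[of _ n n _ n _ n])
      finally show False using N by simp
    qed
  qed
  also have "(\<Union>N\<in>?O. F N) = {P. P \<in> carrier_mat n n \<and> det P \<noteq> 0}"
  proof (intro equalityI subsetI)
    fix P :: "'a mat" assume "P \<in> {P. P \<in> carrier_mat n n \<and> det P \<noteq> 0}"
    then have P: "P \<in> carrier_mat n n" "det P \<noteq> 0" by auto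
    then obtain Q where Q: "Q \<in> carrier_mat n n" "P * Q = 1\<^sub>m n" "Q * P = 1\<^sub>m n"
      using obtain_inverse_mat[OF P(1,2)] by blast
    have c: "P * J * Q \<in> carrier_mat n n" using P Q J by simp
    have "P * J * Q * P = P * J" using P Q J by (simp add: assoc_mult_mat[of _ n n _ n _ n])
    then show "P \<in> (\<Union>N\<in>?O. F N)"
      using P c similar_mat_iff_intertwined[OF c J]
      by (intro UN_I[of "P * J * Q"]) (auto simp: F_def)
  qed (auto simp: F_def)
  finally show ?thesis by (simp add: GL_order_eq_card_det)
qed

section \<open>The rank normal form\<close>

definition rank_nf :: "nat \<Rightarrow> nat \<Rightarrow> nat \<Rightarrow> 'a::semiring_1 mat" where
  "rank_nf a b r = mat a b (\<lambda>(i,j). if i = j \<and> i < r then 1 else 0)"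

lemma rank_nf_carrier [simp]: "rank_nf a b r \<in> carrier_mat a b"
  "dim_row (rank_nf a b r) = a" "dim_col (rank_nf a b r) = b"
  by (auto simp: rank_nf_def)

lemma index_rank_nf_mult:
  assumes "Y \<in> carrier_mat b c" "r \<le> b" "i < a" "j < c"
  shows "(rank_nf a b r * Y) $$ (i,j) = (if i < r then Y $$ (i,j) else 0)"
proof -
  have "(rank_nf a b r * Y) $$ (i,j) = (\<Sum>k<b. if i = k then (if i < r then Y $$ (k,j) else 0) else 0)"
    using assms by (subst index_mult_mat_sum[of _ a b]) (auto simp: rank_nf_def simp del: sum.delta sum.delta' intro!: sum.cong)
  then show ?thesis using assms by simp
qed

lemma index_mult_rank_nf:
  assumes "Z \<in> carrier_mat c a" "r \<le> a" "i < c" "j < b"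
  shows "(Z * rank_nf a b r) $$ (i,j) = (if j < r then Z $$ (i,j) else 0)"
proof -
  have "(Z * rank_nf a b r) $$ (i,j) = (\<Sum>k<a. if j = k then (if j < r then Z $$ (i,k) else 0) else 0)"
    using assms by (subst index_mult_mat_sum[of _ c a]) (auto simp: rank_nf_def simp del: sum.delta sum.delta' intro!: sum.cong)
  then show ?thesis using assms by simp
qed

text \<open>
  One step of Gaussian elimination in both directions. If \<open>A\<close> has the blocks \<open>a\<close>, \<open>u\<close>, \<open>v\<close>,
  \<open>w\<close> with pivot \<open>a\<close>, clearing the first column below the pivot and the first row to its right
  leaves the Schur complement \<open>W = w - v a\<^sup>-\<^sup>1 u\<close>.
\<close>

lemma pivot_factorization:
  fixes A :: "'a::field mat"
  assumes A: "A \<in> carrier_mat (1 + nr) (1 + nc)" and nz: "A $$ (0,0) \<noteq> 0"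
  obtains L W U where "L \<in> carrier_mat (1 + nr) (1 + nr)" "W \<in> carrier_mat nr nc"
    "U \<in> carrier_mat (1 + nc) (1 + nc)" "det L \<noteq> 0" "det U \<noteq> 0"
    "A = L * four_block_mat (1\<^sub>m 1) (0\<^sub>m 1 nc) (0\<^sub>m nr 1) W * U"
proof -
  obtain a u v W where b: "a \<in> carrier_mat 1 1" "u \<in> carrier_mat 1 nc" "v \<in> carrier_mat nr 1"
    "W \<in> carrier_mat nr nc" and Ab: "A = four_block_mat a u v W"
    using mat_split_blocks[OF A] by blast
  from nz b Ab have a0: "a $$ (0,0) \<noteq> 0" by auto
  define v' where "v' = mat nr 1 (\<lambda>(i,j). v $$ (i,0) / a $$ (0,0))"
  have v'[simp]: "v' \<in> carrier_mat nr 1" by (simp add: v'_def)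
  have v'a: "v' * a = v"
    by (rule eq_matI) (use a0 b in \<open>auto simp: v'_def scalar_prod_def\<close>)
  have deta: "det a \<noteq> 0" using a0 b by (simp add: det_single)
  define L where "L = four_block_mat (1\<^sub>m 1) (0\<^sub>m 1 nr) v' (1\<^sub>m nr)"
  define U where "U = four_block_mat a u (0\<^sub>m nc 1) (1\<^sub>m nc)"
  let ?W = "W - v' * u"
  have W': "?W \<in> carrier_mat nr nc" using b v' by (intro minus_carrier_mat mult_carrier_mat)
  have eq: "v' * u + ?W = W"
    by (rule eq_matI) (use b v' in \<open>auto simp del: index_mult_mat(1)\<close>)
  have "L * four_block_mat (1\<^sub>m 1) (0\<^sub>m 1 nc) (0\<^sub>m nr 1) ?W =
      four_block_mat (1\<^sub>m 1) (0\<^sub>m 1 nc) v' ?W"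
    unfolding L_def
    by (subst mult_four_block_mat[of _ 1 1 _ nr _ nr _ _ 1 _ nc]) (use b(1,2) v' W' in simp_all)
  also have "\<dots> * U = A"
    unfolding U_def Ab
    by (subst mult_four_block_mat[of _ 1 1 _ nc _ nr _ _ 1 _ nc]) (use b(1-3) v' W' v'a eq in simp_all)
  finally have "A = L * four_block_mat (1\<^sub>m 1) (0\<^sub>m 1 nc) (0\<^sub>m nr 1) ?W * U" ..
  moreover have "det L = 1"
    unfolding L_def by (subst det_four_block_mat_upper_right_zero[of _ 1 _ nr]) (use v' in auto)
  moreover have "det U = det a"
    unfolding U_def using b by (subst det_four_block_mat_lower_left_zero[of _ 1 _ nc]) auto
  moreover have "L \<in> carrier_mat (1 + nr) (1 + nr)" "U \<in> carrier_mat (1 + nc) (1 + nc)"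
    unfolding L_def U_def using b by (auto intro!: four_block_carrier_mat)
  ultimately show thesis using that[of L ?W U] W' deta by auto
qed

lemma swap_to_pivot:
  fixes A :: "'a::field mat"
  assumes A: "A \<in> carrier_mat nr nc" and ij: "i < nr" "j < nc" "A $$ (i,j) \<noteq> 0"
  obtains S B T where "S \<in> carrier_mat nr nr" "B \<in> carrier_mat nr nc" "T \<in> carrier_mat nc nc"
    "det S \<noteq> 0" "det T \<noteq> 0" "A = S * B * T" "B $$ (0,0) \<noteq> 0"
proof -
  let ?S = "swaprows_mat nr 0 i :: 'a mat" and ?T = "swaprows_mat nc 0 j :: 'a mat"
  let ?B = "swapcols 0 j (swaprows 0 i A)"
  have inv: "?S * ?S = 1\<^sub>m nr" "?T * ?T = 1\<^sub>m nc"
    using ij by (auto intro!: swaprows_mat_inv)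
  have det: "det ?S \<noteq> 0" "det ?T \<noteq> 0"
    using ij by (auto intro!: unit_imp_det_non_zero swaprows_mat_Unit)
  have "swaprows 0 i A = ?S * A" using A ij by (intro swaprows_mat) auto
  moreover have "?B = swaprows 0 i A * ?T" using A ij by (intro swapcols_mat[of _ nr]) auto
  ultimately have "?B = ?S * A * ?T" by simp
  then have "?S * ?B * ?T = ?S * (?S * A * ?T) * ?T" by simp
  also have "\<dots> = (?S * ?S) * A * (?T * ?T)"
    using A by (simp add: mult_mat_assoc)
  also have "\<dots> = A" using A inv by simp
  finally have "A = ?S * ?B * ?T" ..
  moreover have "?B $$ (0,0) \<noteq> 0" using A ij by auto
  ultimately show thesis using that[of ?S ?B ?T] A det by auto
qed

text \<open>
  Induction on the number of rows: unless the matrix is zero, move a nonzero entry to the corner,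
  eliminate, and apply the induction hypothesis to the Schur complement.
\<close>

lemma rank_normal_form:
  fixes A :: "'a::field mat"
  assumes "A \<in> carrier_mat nr nc"
  shows "\<exists>P Q r. P \<in> carrier_mat nr nr \<and> Q \<in> carrier_mat nc nc \<and> det P \<noteq> 0 \<and> det Q \<noteq> 0 \<and>
    r \<le> nr \<and> r \<le> nc \<and> A = P * rank_nf nr nc r * Q"
  using assms
proof (induction nr arbitrary: nc A)
  case 0
  have "A = 1\<^sub>m 0 * rank_nf 0 nc 0 * 1\<^sub>m nc"
    using 0 by (intro eq_matI) (auto simp del: left_mult_one_mat right_mult_one_mat)
  then show ?case by (intro exI[of _ "1\<^sub>m 0"] exI[of _ "1\<^sub>m nc"] exI[of _ 0]) auto
next
  case (Suc nr)
  show ?case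
  proof (cases "\<exists>i j. i < Suc nr \<and> j < nc \<and> A $$ (i,j) \<noteq> 0")
    case False
    then have "A = 1\<^sub>m (Suc nr) * rank_nf (Suc nr) nc 0 * 1\<^sub>m nc"
      using Suc.prems by (intro eq_matI) (auto simp: left_mult_one_mat[of _ _ nc] right_mult_one_mat[of _ "Suc nr"] rank_nf_def)
    then show ?thesis by (intro exI[of _ "1\<^sub>m (Suc nr)"] exI[of _ "1\<^sub>m nc"] exI[of _ 0]) auto
  next
    case True
    then obtain i j where ij: "i < Suc nr" "j < nc" "A $$ (i,j) \<noteq> 0" by blast
    then obtain m where nc: "nc = Suc m" by (cases nc) auto
    obtain S B T where S: "S \<in> carrier_mat (Suc nr) (Suc nr)" "B \<in> carrier_mat (Suc nr) nc"
      "T \<in> carrier_mat nc nc" "det S \<noteq> 0" "det T \<noteq> 0" "A = S * B * T" "B $$ (0,0) \<noteq> 0"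
      using swap_to_pivot[OF Suc.prems ij] by blast
    have "B \<in> carrier_mat (1 + nr) (1 + m)" using S nc by simp
    then obtain L W U where L: "L \<in> carrier_mat (1 + nr) (1 + nr)" "W \<in> carrier_mat nr m"
      "U \<in> carrier_mat (1 + m) (1 + m)" "det L \<noteq> 0" "det U \<noteq> 0"
      "B = L * four_block_mat (1\<^sub>m 1) (0\<^sub>m 1 m) (0\<^sub>m nr 1) W * U"
      using pivot_factorization[OF _ S(7)] by blast
    obtain P Q r where P: "P \<in> carrier_mat nr nr" "Q \<in> carrier_mat m m" "det P \<noteq> 0" "det Q \<noteq> 0"
      "r \<le> nr" "r \<le> m" "W = P * rank_nf nr m r * Q"
      using Suc.IH[OF L(2)] by blast
    define P1 where "P1 = four_block_mat (1\<^sub>m 1) (0\<^sub>m 1 nr) (0\<^sub>m nr 1) P"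
    define Q1 where "Q1 = four_block_mat (1\<^sub>m 1) (0\<^sub>m 1 m) (0\<^sub>m m 1) Q"
    define E1 where "E1 = (rank_nf (1 + nr) (1 + m) (Suc r) :: 'a mat)"
    have E1: "E1 = four_block_mat (1\<^sub>m 1) (0\<^sub>m 1 m) (0\<^sub>m nr 1) (rank_nf nr m r)"
      unfolding E1_def by (rule eq_matI) (auto simp: rank_nf_def)
    have c: "P1 \<in> carrier_mat (1 + nr) (1 + nr)" "Q1 \<in> carrier_mat (1 + m) (1 + m)"
      "E1 \<in> carrier_mat (1 + nr) (1 + m)"
      unfolding P1_def Q1_def E1_def using P by (auto intro!: four_block_carrier_mat)
    have "P1 * E1 = four_block_mat (1\<^sub>m 1) (0\<^sub>m 1 m) (0\<^sub>m nr 1) (P * rank_nf nr m r)"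
      unfolding P1_def E1
      by (subst mult_four_block_mat[of _ 1 1 _ nr _ nr _ _ 1 _ m]) (use P in auto)
    also have "\<dots> * Q1 = four_block_mat (1\<^sub>m 1) (0\<^sub>m 1 m) (0\<^sub>m nr 1) W"
      unfolding Q1_def P(7)
      by (subst mult_four_block_mat[of _ 1 1 _ m _ nr _ _ 1 _ m]) (use P in auto)
    finally have B: "B = L * (P1 * E1 * Q1) * U" using L(6) by simp
    have "det P1 = det P"
      unfolding P1_def using P by (subst det_four_block_mat_upper_right_zero[of _ 1 _ nr]) auto
    then have dP: "det (S * L * P1) \<noteq> 0"
      using S L P c by (simp add: det_mult[of _ "Suc nr"])
    have "det Q1 = det Q"
      unfolding Q1_def using P by (subst det_four_block_mat_upper_right_zero[of _ 1 _ m]) auto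
    then have dQ: "det (Q1 * U * T) \<noteq> 0"
      using S L P c nc by (simp add: det_mult[of _ "Suc m"])
    have "A = S * (L * (P1 * E1 * Q1) * U) * T" using S(6) B by simp
    also have "\<dots> = S * L * P1 * E1 * (Q1 * U * T)"
      using S(1,3) L(1,3) c nc by (simp add: mult_mat_assoc)
    finally show ?thesis
      using dP dQ S(1,3) L(1,3) c P(5,6) nc
      by (intro exI[of _ "S * L * P1"] exI[of _ "Q1 * U * T"] exI[of _ "Suc r"])
        (auto simp: E1_def)
  qed
qed


text \<open>
  If \<open>b < a\<close>, padding \<open>A\<close> by zero columns and \<open>B\<close> by zero rows gives square matrices with
  product \<open>1\<close>. Then their product in the other order is \<open>1\<close> too, although its row \<open>b\<close> is zero.
\<close>

lemma left_inverse_dim_le: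
  fixes A B :: "'a::field mat"
  assumes A: "A \<in> carrier_mat a b" and B: "B \<in> carrier_mat b a" and AB: "A * B = 1\<^sub>m a"
  shows "a \<le> b"
proof (rule ccontr)
  assume "\<not> a \<le> b"
  then have b: "b < a" by simp
  let ?A = "A * rank_nf b a b" and ?B = "rank_nf a b b * B"
  have id: "rank_nf b a b * rank_nf a b b = (1\<^sub>m b :: 'a mat)"
  proof (rule eq_matI)
    fix i j assume "i < dim_row (1\<^sub>m b :: 'a mat)" "j < dim_col (1\<^sub>m b :: 'a mat)"
    then show "(rank_nf b a b * rank_nf a b b) $$ (i,j) = (1\<^sub>m b :: 'a mat) $$ (i,j)"
      using b by (subst index_rank_nf_mult[of _ a b]) (auto simp: rank_nf_def)
  qed auto
  have "?A * ?B = A * (rank_nf b a b * rank_nf a b b) * B"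
    using A B by (simp add: mult_mat_assoc)
  then have "?A * ?B = 1\<^sub>m a" using A AB id by simp
  then have "?B * ?A = 1\<^sub>m a"
    by (intro mat_mult_left_right_inverse[OF mult_carrier_mat[OF A] mult_carrier_mat[OF _ B]]) simp_all
  moreover have "?B * ?A = rank_nf a b b * (B * ?A)"
    using A B by (intro assoc_mult_mat[of _ a b _ a _ a]) auto
  ultimately have "(rank_nf a b b * (B * ?A)) $$ (b,b) = (1 :: 'a)" using b by simp
  moreover have "(rank_nf a b b * (B * ?A)) $$ (b,b) = 0"
    using A B b by (subst index_rank_nf_mult[of _ b a]) auto
  ultimately show False by simp
qed

section \<open>Square-zero matrices up to similarity\<close>

text \<open>
  With rows and columns split into \<open>i\<close>, \<open>i\<close> and \<open>m\<close>, this matrix has the identity in block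
  \<open>(1,2)\<close> and zeros elsewhere. It is, up to the order of the basis, the Jordan form with \<open>i\<close>
  nilpotent blocks of size two and \<open>m\<close> zero blocks of size one. The dimension is written as
  \<open>i + (i + m)\<close> to fit the outer division into four blocks.
\<close>

definition square_zero_nf :: "nat \<Rightarrow> nat \<Rightarrow> 'a::semiring_1 mat" where
  "square_zero_nf i m = four_block_mat (0\<^sub>m i i) (rank_nf i (i + m) i)
     (0\<^sub>m (i + m) i) (0\<^sub>m (i + m) (i + m))"

lemma square_zero_nf_carrier [simp]: "square_zero_nf i m \<in> carrier_mat (i + (i + m)) (i + (i + m))"
  by (simp add: square_zero_nf_def)

lemma square_zero_nf_square:
  "square_zero_nf i m * square_zero_nf i m = 0\<^sub>m (i + (i + m)) (i + (i + m))"
  unfolding square_zero_nf_def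
  by (subst mult_four_block_mat[of _ i i _ "i + m" _ "i + m" _ _ i _ "i + m"])
    (auto intro!: eq_matI)

text \<open>
  Let \<open>N = P E Q\<close> with \<open>E\<close> the rank normal form of rank \<open>r\<close>. Then \<open>N\<close> is similar to
  \<open>M = E U\<close> with \<open>U = Q P\<close> invertible, and only the first \<open>r\<close> rows of \<open>M\<close> can be nonzero.
  Cancelling \<open>U\<close> in \<open>M M = 0\<close> leaves \<open>M E = 0\<close>: the first \<open>r\<close> columns vanish as well. The
  remaining block \<open>D\<close> has a right inverse because \<open>M\<close> has rank \<open>r\<close>, hence has rank \<open>r\<close> itself.
  Its factorization \<open>D = P\<^sub>2 E\<^sub>2 Q\<^sub>2\<close> conjugates \<open>M\<close> into normal form, since row and column
  operations on \<open>D\<close> act on complementary parts of the basis.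
\<close>

lemma square_zero_similar_nf:
  fixes N :: "'a::field mat"
  assumes N: "N \<in> carrier_mat n n" and NN: "N * N = 0\<^sub>m n n"
  obtains i m where "n = i + (i + m)" "similar_mat N (square_zero_nf i m)"
proof -
  note assoc = assoc_mult_mat[of _ n n _ n _ n]
  obtain P Q r where P: "P \<in> carrier_mat n n" "Q \<in> carrier_mat n n" "det P \<noteq> 0" "det Q \<noteq> 0"
    "r \<le> n" "N = P * rank_nf n n r * Q"
    using rank_normal_form[OF N] by blast
  obtain s where n: "n = r + s" using P(5) le_Suc_ex by blast
  define E where "E = (rank_nf n n r :: 'a mat)"
  define U where "U = Q * P"
  define M where "M = E * U"
  have c: "E \<in> carrier_mat n n" "U \<in> carrier_mat n n" "M \<in> carrier_mat n n"
    using P by (auto simp: E_def U_def M_def)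
  have "det U \<noteq> 0" using P by (simp add: U_def det_mult)
  then obtain V where V: "V \<in> carrier_mat n n" "U * V = 1\<^sub>m n"
    using obtain_inverse_mat[OF c(2)] by blast
  have NP: "N * P = P * M"
    unfolding P(6) M_def U_def E_def[symmetric] using P(1,2) c by (simp add: assoc)
  then have sim: "similar_mat N M"
    using similar_mat_iff_intertwined[OF N c(3)] P by blast
  \<comment> \<open>\<open>V\<close> serves twice: to cancel \<open>U\<close> in \<open>M * M = 0\<close>, and to supply a right inverse of \<open>D\<close>.\<close>
  have MV: "M * V = E" unfolding M_def using c V by (simp add: assoc)
  have MM: "M * M = 0\<^sub>m n n"
  proof -
    obtain P' where P': "P' \<in> carrier_mat n n" "P' * P = 1\<^sub>m n"
      using obtain_inverse_mat[OF P(1,3)] by blast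
    have "P * (M * M) = (P * M) * M" using P(1) c by (simp add: assoc)
    also have "\<dots> = (N * P) * M" by (simp only: NP)
    also have "\<dots> = N * (P * M)" using N P(1) c by (simp add: assoc)
    also have "\<dots> = N * (N * P)" by (simp only: NP)
    also have "\<dots> = (N * N) * P" using N P(1) by (simp add: assoc)
    finally have "P * (M * M) = 0\<^sub>m n n" using NN P(1) by simp
    then have "P' * (P * (M * M)) = 0\<^sub>m n n" using P' by simp
    moreover have "P' * (P * (M * M)) = (P' * P) * (M * M)" using P'(1) P(1) c by (simp add: assoc)
    ultimately show ?thesis using P' c by simp
  qed
  have "M * E = M * M * V" unfolding MV[symmetric] using c V by (simp add: assoc)
  then have ME: "M * E = 0\<^sub>m n n" using MM V by simp
  have M_left: "M $$ (a,b) = 0" if "a < n" "b < r" for a b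
  proof -
    have "(M * E) $$ (a,b) = M $$ (a,b)"
      unfolding E_def using that P(5) c by (subst index_mult_rank_nf[of _ n n]) auto
    then show ?thesis unfolding ME using that P(5) by simp
  qed
  have M_below: "M $$ (a,b) = 0" if "r \<le> a" "a < n" "b < n" for a b
    unfolding M_def E_def using that P(5) c by (subst index_rank_nf_mult[of _ n n]) auto
  define D where "D = mat r s (\<lambda>(a,b). M $$ (a, r + b))"
  have D: "D \<in> carrier_mat r s" by (simp add: D_def)
  have M_block: "M = four_block_mat (0\<^sub>m r r) D (0\<^sub>m s r) (0\<^sub>m s s)"
    by (rule eq_matI) (use c n M_left M_below in \<open>auto simp: D_def\<close>)
  obtain V1 V2 V3 V4 where Vb: "V1 \<in> carrier_mat r r" "V2 \<in> carrier_mat r s"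
    "V3 \<in> carrier_mat s r" "V4 \<in> carrier_mat s s" "V = four_block_mat V1 V2 V3 V4"
    using mat_split_blocks[of V r s r s] V n by blast
  have "M * V = four_block_mat (D * V3) (D * V4) (0\<^sub>m s r) (0\<^sub>m s s)"
    unfolding M_block Vb(5)
    by (subst mult_four_block_mat[of _ r r _ s _ s _ _ r _ s]) (use Vb D in auto)
  moreover have "E = four_block_mat (1\<^sub>m r) (0\<^sub>m r s) (0\<^sub>m s r) (0\<^sub>m s s)"
    unfolding E_def n by (rule eq_matI) (auto simp: rank_nf_def)
  ultimately have "four_block_mat (D * V3) (D * V4) (0\<^sub>m s r) (0\<^sub>m s s) =
      four_block_mat (1\<^sub>m r) (0\<^sub>m r s) (0\<^sub>m s r) (0\<^sub>m s s)"
    using MV by simp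
  from four_block_mat_eqD(1)[OF this, of r r s s] have DV: "D * V3 = 1\<^sub>m r"
    using D Vb by auto
  obtain P2 Q2 t where P2: "P2 \<in> carrier_mat r r" "Q2 \<in> carrier_mat s s" "det P2 \<noteq> 0" "det Q2 \<noteq> 0"
    "t \<le> r" "t \<le> s" "D = P2 * rank_nf r s t * Q2"
    using rank_normal_form[OF D] by blast
  \<comment> \<open>If \<open>t < r\<close>, row \<open>t\<close> of \<open>rank_nf r s t\<close> is zero, which excludes a right inverse of \<open>D\<close>.\<close>
  have "t = r"
  proof (rule ccontr)
    assume "t \<noteq> r"
    then have t: "t < r" using P2(5) by simp
    let ?X = "rank_nf r s t * (Q2 * V3)"
    have "P2 * ?X = 1\<^sub>m r"
      unfolding DV[symmetric] P2(7) using P2(1,2) Vb(3)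
      by (simp add: mult_mat_assoc)
    then have "?X * P2 = 1\<^sub>m r"
      using P2(2) Vb(3)
      by (intro mat_mult_left_right_inverse[OF P2(1) mult_carrier_mat[of _ r s]]) simp_all
    moreover have "?X * P2 = rank_nf r s t * ((Q2 * V3) * P2)"
      using P2 Vb by (intro assoc_mult_mat[of _ r s _ r _ r]) auto
    ultimately have "(rank_nf r s t * ((Q2 * V3) * P2)) $$ (t,t) = 1" using t by simp
    moreover have "(rank_nf r s t * ((Q2 * V3) * P2)) $$ (t,t) = 0"
      using P2 Vb t by (subst index_rank_nf_mult[of _ s r]) auto
    ultimately show False by simp
  qed
  then obtain m where s: "s = r + m" using P2(6) le_Suc_ex by blast
  obtain S where S: "S \<in> carrier_mat s s" "Q2 * S = 1\<^sub>m s" "det S \<noteq> 0"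
    using obtain_inverse_mat[OF P2(2,4)] by blast
  define T where "T = four_block_mat P2 (0\<^sub>m r s) (0\<^sub>m s r) S"
  have T: "T \<in> carrier_mat n n" unfolding T_def n using P2 S by simp
  have "det T \<noteq> 0"
    unfolding T_def using P2 S by (subst det_four_block_mat_upper_right_zero[of _ r _ s]) auto
  moreover have "M * T = T * square_zero_nf r m"
  proof -
    have DS: "D * S = P2 * rank_nf r s r"
      unfolding P2(7) \<open>t = r\<close> using P2(1,2) S
      by (simp add: mult_mat_assoc[of "P2 * rank_nf r s r" Q2 S])
    have "M * T = four_block_mat (0\<^sub>m r r) (D * S) (0\<^sub>m s r) (0\<^sub>m s s)"
      unfolding M_block T_def
      by (subst mult_four_block_mat[of _ r r _ s _ s _ _ r _ s]) (use P2 S D in auto)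
    moreover have "T * square_zero_nf r m =
        four_block_mat (0\<^sub>m r r) (P2 * rank_nf r s r) (0\<^sub>m s r) (0\<^sub>m s s)"
      unfolding T_def square_zero_nf_def s[symmetric]
      by (subst mult_four_block_mat[of _ r r _ s _ s _ _ r _ s]) (use P2 S in auto)
    ultimately show ?thesis using DS by simp
  qed
  moreover have nm: "n = r + (r + m)" using n s by simp
  ultimately have "similar_mat M (square_zero_nf r m)"
    using similar_mat_iff_intertwined[OF c(3), of "square_zero_nf r m"] T by auto
  with sim have "similar_mat N (square_zero_nf r m)" by (rule similar_mat_trans)
  with nm that show thesis by blast
qed

lemma index_square_zero_nf:
  "a < i + (i + m) \<Longrightarrow> b < i + (i + m) \<Longrightarrow>
    square_zero_nf i m $$ (a,b) = (if a < i \<and> b = i + a then 1 else 0)"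
  by (auto simp: square_zero_nf_def rank_nf_def)

text \<open>
  The number \<open>i\<close> is the rank. Concretely, if an invertible \<open>P\<close> intertwines the two normal forms,
  the block of its first \<open>j\<close> columns vanishes below row \<open>i\<close>; its first \<open>i\<close> rows then form an
  \<open>i \<times> j\<close> matrix with a left inverse, so \<open>j \<le> i\<close>.
\<close>

lemma similar_square_zero_nf_le:
  assumes n: "n = i + (i + m)" "n = j + (j + l)"
    and sim: "similar_mat (square_zero_nf i m :: 'a::field mat) (square_zero_nf j l)"
  shows "j \<le> i"
proof -
  let ?J = "square_zero_nf i m :: 'a mat" and ?K = "square_zero_nf j l :: 'a mat"
  have c: "?J \<in> carrier_mat n n" "?K \<in> carrier_mat n n" using n by (metis square_zero_nf_carrier)+
  obtain P where P: "P \<in> carrier_mat n n" "det P \<noteq> 0" "?J * P = P * ?K"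
    using sim similar_mat_iff_intertwined[OF c] by blast
  obtain V where V: "V \<in> carrier_mat n n" "V * P = 1\<^sub>m n"
    using obtain_inverse_mat[OF P(1,2)] by blast
  \<comment> \<open>Compare entry \<open>(i + a, j + b)\<close> of \<open>?J * P\<close>, whose rows from \<open>i\<close> on vanish, with that of
     \<open>P * ?K\<close>, which is entry \<open>b\<close> of row \<open>i + a\<close> of \<open>P\<close>.\<close>
  have P0: "P $$ (i + a, b) = 0" if "a < i + m" "b < j" for a b
  proof -
    from that have lt: "i + a < n" unfolding n(1) by simp
    from that have lt': "j + b < n" "b < n" unfolding n(2) by simp_all
    have "(?J * P) $$ (i + a, j + b) = (\<Sum>k<n. 0)"
      unfolding index_mult_mat_sum[OF c(1) P(1) lt lt'(1)]
      using lt n(1) by (intro sum.cong) (simp_all add: index_square_zero_nf)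
    moreover have "(P * ?K) $$ (i + a, j + b) = (\<Sum>k<n. if k = b then P $$ (i + a, k) else 0)"
      unfolding index_mult_mat_sum[OF P(1) c(2) lt lt'(1)]
      using lt'(1) n(2) that(2) by (intro sum.cong) (auto simp: index_square_zero_nf)
    ultimately show ?thesis using lt'(2) by (simp add: P(3))
  qed
  have Pc: "P \<in> carrier_mat (i + (i + m)) (j + (j + l))"
    unfolding n(1)[symmetric] n(2)[symmetric] by (rule P(1))
  have Vc: "V \<in> carrier_mat (j + (j + l)) (i + (i + m))"
    unfolding n(1)[symmetric] n(2)[symmetric] by (rule V(1))
  obtain P1 P2 P3 P4 where Pb: "P1 \<in> carrier_mat i j" "P2 \<in> carrier_mat i (j + l)"
    "P3 \<in> carrier_mat (i + m) j" "P4 \<in> carrier_mat (i + m) (j + l)" "P = four_block_mat P1 P2 P3 P4"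
    using mat_split_blocks[OF Pc] by blast
  obtain V1 V2 V3 V4 where Vb: "V1 \<in> carrier_mat j i" "V2 \<in> carrier_mat j (i + m)"
    "V3 \<in> carrier_mat (j + l) i" "V4 \<in> carrier_mat (j + l) (i + m)" "V = four_block_mat V1 V2 V3 V4"
    using mat_split_blocks[OF Vc] by blast
  have "P3 = 0\<^sub>m (i + m) j"
  proof (rule eq_matI)
    fix a b assume "a < dim_row (0\<^sub>m (i + m) j :: 'a mat)" "b < dim_col (0\<^sub>m (i + m) j :: 'a mat)"
    then show "P3 $$ (a,b) = 0\<^sub>m (i + m) j $$ (a,b)" using P0[of a b] Pb by auto
  qed (use Pb in auto)
  then have "V2 * P3 = 0\<^sub>m j j" using Vb by simp
  have "V * P = four_block_mat (V1 * P1 + V2 * P3) (V1 * P2 + V2 * P4)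
      (V3 * P1 + V4 * P3) (V3 * P2 + V4 * P4)"
    unfolding Pb(5) Vb(5) by (rule mult_four_block_mat) (use Pb Vb in auto)
  moreover have "1\<^sub>m n = four_block_mat (1\<^sub>m j) (0\<^sub>m j (j + l)) (0\<^sub>m (j + l) j) (1\<^sub>m (j + l) :: 'a mat)"
    unfolding n(2) by simp
  ultimately have "four_block_mat (V1 * P1 + V2 * P3) (V1 * P2 + V2 * P4)
      (V3 * P1 + V4 * P3) (V3 * P2 + V4 * P4) =
      four_block_mat (1\<^sub>m j) (0\<^sub>m j (j + l)) (0\<^sub>m (j + l) j) (1\<^sub>m (j + l))"
    using V by simp
  from four_block_mat_eqD(1)[OF this, of j j "j + l" "j + l"]
  have "V1 * P1 + V2 * P3 = 1\<^sub>m j" using Pb Vb by auto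
  then have "V1 * P1 = 1\<^sub>m j" using \<open>V2 * P3 = 0\<^sub>m j j\<close> Pb Vb by simp
  then show ?thesis using left_inverse_dim_le Pb Vb by blast
qed


section \<open>The centralizer of the normal form\<close>

text \<open>
  Multiplying by the normal form \<open>J\<close> moves blocks around: with \<open>K = (1 0)\<close> of size
  \<open>i \<times> (i + m)\<close>, the nonzero blocks of \<open>S J\<close> are \<open>A K\<close> and \<open>Z K\<close>, those of \<open>J S\<close> are \<open>K Z\<close>
  and \<open>K Y\<close>. So \<open>S\<close> commutes with \<open>J\<close> just when \<open>Z = 0\<close> and the top rows of \<open>Y\<close> are \<open>(A 0)\<close>.
\<close>

lemma commutes_square_zero_nf_iff:
  fixes A X Z Y :: "'a::field mat"
  assumes A: "A \<in> carrier_mat i i" and X: "X \<in> carrier_mat i (i + m)"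
    and Z: "Z \<in> carrier_mat (i + m) i" and Y: "Y \<in> carrier_mat (i + m) (i + m)"
  shows "four_block_mat A X Z Y * square_zero_nf i m = square_zero_nf i m * four_block_mat A X Z Y
    \<longleftrightarrow> Z = 0\<^sub>m (i + m) i \<and>
      (\<exists>E \<in> carrier_mat m i. \<exists>D \<in> carrier_mat m m. Y = four_block_mat A (0\<^sub>m i m) E D)"
    (is "?comm \<longleftrightarrow> ?block")
proof -
  define K where "K = (rank_nf i (i + m) i :: 'a mat)"
  have K: "K \<in> carrier_mat i (i + m)" by (simp add: K_def)
  let ?J = "four_block_mat (0\<^sub>m i i) K (0\<^sub>m (i + m) i) (0\<^sub>m (i + m) (i + m))"
  have left: "four_block_mat A X Z Y * ?J =
      four_block_mat (0\<^sub>m i i) (A * K) (0\<^sub>m (i + m) i) (Z * K)"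
    by (subst mult_four_block_mat[of _ i i _ "i + m" _ "i + m" _ _ i _ "i + m"]) (use A X Y Z K in auto)
  have right: "?J * four_block_mat A X Z Y =
      four_block_mat (K * Z) (K * Y) (0\<^sub>m (i + m) i) (0\<^sub>m (i + m) (i + m))"
    by (subst mult_four_block_mat[of _ i i _ "i + m" _ "i + m" _ _ i _ "i + m"]) (use A X Y Z K in auto)
  have AK: "(A * K) $$ (a,b) = (if b < i then A $$ (a,b) else 0)" if "a < i" "b < i + m" for a b
    unfolding K_def by (rule index_mult_rank_nf[OF A le_refl that])
  have KY: "(K * Y) $$ (a,b) = Y $$ (a,b)" if "a < i" "b < i + m" for a b
    unfolding K_def using index_rank_nf_mult[OF Y le_add1 that] that by simp
  have ZK: "(Z * K) $$ (a,b) = Z $$ (a,b)" if "a < i + m" "b < i" for a b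
    unfolding K_def using index_mult_rank_nf[OF Z le_refl that(1), of b] that by simp
  have "?comm \<longleftrightarrow> four_block_mat (0\<^sub>m i i) (A * K) (0\<^sub>m (i + m) i) (Z * K) =
      four_block_mat (K * Z) (K * Y) (0\<^sub>m (i + m) i) (0\<^sub>m (i + m) (i + m))"
    unfolding square_zero_nf_def K_def[symmetric] left right ..
  also have "\<dots> \<longleftrightarrow> ?block"
  proof
    assume eq: "four_block_mat (0\<^sub>m i i) (A * K) (0\<^sub>m (i + m) i) (Z * K) =
      four_block_mat (K * Z) (K * Y) (0\<^sub>m (i + m) i) (0\<^sub>m (i + m) (i + m))"
    note c = zero_carrier_mat mult_carrier_mat[OF A K] zero_carrier_mat mult_carrier_mat[OF Z K]
      mult_carrier_mat[OF K Z] mult_carrier_mat[OF K Y] zero_carrier_mat zero_carrier_mat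
    have "Z * K = 0\<^sub>m (i + m) (i + m)" and AKY: "A * K = K * Y"
      using four_block_mat_eqD(2,4)[OF eq c] by simp_all
    have Z0: "Z = 0\<^sub>m (i + m) i"
    proof (rule eq_matI)
      fix a b assume ab: "a < dim_row (0\<^sub>m (i + m) i :: 'a mat)" "b < dim_col (0\<^sub>m (i + m) i :: 'a mat)"
      then have "Z $$ (a,b) = (Z * K) $$ (a,b)" using ZK[of a b] by simp
      then show "Z $$ (a,b) = 0\<^sub>m (i + m) i $$ (a,b)"
        using ab \<open>Z * K = _\<close> by simp
    qed (use Z in auto)
    obtain Y1 Y2 E D where Yb: "Y1 \<in> carrier_mat i i" "Y2 \<in> carrier_mat i m"
      "E \<in> carrier_mat m i" "D \<in> carrier_mat m m" "Y = four_block_mat Y1 Y2 E D"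
      using mat_split_blocks[OF Y] by blast
    have top: "Y $$ (a,b) = (if b < i then A $$ (a,b) else 0)" if "a < i" "b < i + m" for a b
      using AK[OF that] KY[OF that] AKY by simp
    have "Y1 = A"
    proof (rule eq_matI)
      fix a b assume "a < dim_row A" "b < dim_col A"
      then show "Y1 $$ (a,b) = A $$ (a,b)" using top[of a b] Yb A by simp
    qed (use Yb A in auto)
    moreover have "Y2 = 0\<^sub>m i m"
    proof (rule eq_matI)
      fix a b assume "a < dim_row (0\<^sub>m i m :: 'a mat)" "b < dim_col (0\<^sub>m i m :: 'a mat)"
      then show "Y2 $$ (a,b) = 0\<^sub>m i m $$ (a,b)" using top[of a "i + b"] Yb by simp
    qed (use Yb in auto)
    ultimately show ?block using Z0 Yb by blast
  next
    assume ?block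
    then obtain E D where b: "Z = 0\<^sub>m (i + m) i" "E \<in> carrier_mat m i" "D \<in> carrier_mat m m"
      "Y = four_block_mat A (0\<^sub>m i m) E D" by blast
    have "A * K = K * Y"
    proof (rule eq_matI)
      fix a b' assume "a < dim_row (K * Y)" "b' < dim_col (K * Y)"
      then have lt: "a < i" "b' < i + m" using K Y by simp_all
      then show "(A * K) $$ (a,b') = (K * Y) $$ (a,b')"
        unfolding AK[OF lt] KY[OF lt] using A b(2-4) by simp
    qed (use A K Y in simp_all)
    moreover have "K * Z = 0\<^sub>m i i" "Z * K = 0\<^sub>m (i + m) (i + m)"
      unfolding b(1) using K by (simp_all add: left_mult_zero_mat right_mult_zero_mat)
    ultimately show "four_block_mat (0\<^sub>m i i) (A * K) (0\<^sub>m (i + m) i) (Z * K) =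
      four_block_mat (K * Z) (K * Y) (0\<^sub>m (i + m) i) (0\<^sub>m (i + m) (i + m))" by simp
  qed
  finally show ?thesis .
qed

text \<open>
  By \<open>commutes_square_zero_nf_iff\<close> a commuting matrix is block upper triangular with a block
  lower triangular matrix in its lower right corner. Its determinant is
  \<open>det A * (det A * det D)\<close>, so invertibility restricts only \<open>A\<close> and \<open>D\<close>, while \<open>X\<close> and \<open>E\<close>
  are free.
\<close>

lemma card_centralizer_square_zero_nf:
  fixes i m :: nat
  defines "n \<equiv> i + (i + m)"
  shows "card {S :: 'a::{field, finite} mat. S \<in> carrier_mat n n \<and> det S \<noteq> 0 \<and>
      S * square_zero_nf i m = square_zero_nf i m * S} =
    card (UNIV :: 'a set) ^ (i * (2 * n - 3 * i)) * GL_order TYPE('a) i * GL_order TYPE('a) m"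
proof -
  let ?GL = "\<lambda>k. {P :: 'a mat. P \<in> carrier_mat k k \<and> det P \<noteq> 0}"
  let ?C = "{S :: 'a mat. S \<in> carrier_mat n n \<and> det S \<noteq> 0 \<and>
      S * square_zero_nf i m = square_zero_nf i m * S}"
  let ?Y = "\<lambda>A E D. four_block_mat A (0\<^sub>m i m) E D"
  let ?F = "\<lambda>(A, D, X, E). four_block_mat A X (0\<^sub>m (i + m) i) (?Y A E D)"
  let ?B = "?GL i \<times> ?GL m \<times> (carrier_mat i (i + m) :: 'a mat set) \<times>
    (carrier_mat m i :: 'a mat set)"
  have Yc: "?Y A E D \<in> carrier_mat (i + m) (i + m)"
    if "A \<in> carrier_mat i i" "D \<in> carrier_mat m m" for A E D :: "'a mat"
    using that by simp
  have detF: "det (?F (A, D, X, E)) = det A * (det A * det D)"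
    if "A \<in> carrier_mat i i" "D \<in> carrier_mat m m" "X \<in> carrier_mat i (i + m)" "E \<in> carrier_mat m i"
    for A D X E :: "'a mat"
    using that det_four_block_mat_lower_left_zero[OF that(1,3) refl Yc[OF that(1,2)]]
      det_four_block_mat_upper_right_zero[OF that(1) refl that(4,2)] by simp
  have "bij_betw ?F ?B ?C"
    unfolding bij_betw_def
  proof
    show "inj_on ?F ?B"
    proof (rule inj_onI)
      fix x x' assume x: "x \<in> ?B" "x' \<in> ?B" and eq: "?F x = ?F x'"
      obtain A D X E where xd: "x = (A, D, X, E)" by (cases x)
      obtain A' D' X' E' where xd': "x' = (A', D', X', E')" by (cases x')
      from x have c: "A \<in> carrier_mat i i" "D \<in> carrier_mat m m" "X \<in> carrier_mat i (i + m)"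
          "E \<in> carrier_mat m i"
        and c': "A' \<in> carrier_mat i i" "D' \<in> carrier_mat m m" "X' \<in> carrier_mat i (i + m)"
          "E' \<in> carrier_mat m i"
        unfolding xd xd' by simp_all
      note outer = four_block_mat_eqD[OF eq[unfolded xd xd' split] c(1,3) zero_carrier_mat
          Yc[OF c(1,2)] c'(1,3) zero_carrier_mat Yc[OF c'(1,2)]]
      note inner = four_block_mat_eqD[OF outer(4) c(1) zero_carrier_mat c(4,2)
          c'(1) zero_carrier_mat c'(4,2)]
      show "x = x'" unfolding xd xd' using outer(1,2) inner(3,4) by simp
    qed
    show "?F ` ?B = ?C"
    proof (intro equalityI subsetI)
      fix S assume "S \<in> ?F ` ?B"
      then obtain A D X E where S: "S = ?F (A, D, X, E)" and B: "(A, D, X, E) \<in> ?B" by auto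
      from B have c: "A \<in> carrier_mat i i" "D \<in> carrier_mat m m" "X \<in> carrier_mat i (i + m)"
          "E \<in> carrier_mat m i" and d: "det A \<noteq> 0" "det D \<noteq> 0" by simp_all
      have "S \<in> carrier_mat n n" unfolding S n_def split by (rule four_block_carrier_mat[OF c(1) Yc[OF c(1,2)]])
      moreover have "det S \<noteq> 0" unfolding S detF[OF c] using d by simp
      moreover have "S * square_zero_nf i m = square_zero_nf i m * S"
        unfolding S split using commutes_square_zero_nf_iff[OF c(1,3) zero_carrier_mat Yc[OF c(1,2)]] c by blast
      ultimately show "S \<in> ?C" by simp
    next
      fix S assume "S \<in> ?C"
      then have S: "S \<in> carrier_mat (i + (i + m)) (i + (i + m))" "det S \<noteq> 0"
        "S * square_zero_nf i m = square_zero_nf i m * S" by (simp_all add: n_def)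
      obtain A X Z Y where b: "A \<in> carrier_mat i i" "X \<in> carrier_mat i (i + m)"
        "Z \<in> carrier_mat (i + m) i" "Y \<in> carrier_mat (i + m) (i + m)" "S = four_block_mat A X Z Y"
        using mat_split_blocks[OF S(1)] by blast
      obtain E D where ED: "E \<in> carrier_mat m i" "D \<in> carrier_mat m m" "Y = ?Y A E D"
        and Z: "Z = 0\<^sub>m (i + m) i"
        using S(3) commutes_square_zero_nf_iff[OF b(1-4)] unfolding b(5) by blast
      have F: "S = ?F (A, D, X, E)" unfolding b(5) Z ED(3) split ..
      have "det A \<noteq> 0 \<and> det D \<noteq> 0"
        using S(2) unfolding F detF[OF b(1) ED(2) b(2) ED(1)] by auto
      then show "S \<in> ?F ` ?B" unfolding F using b(1,2) ED(1,2) by (intro imageI) simp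
    qed
  qed
  have exponent: "i * (2 * n - 3 * i) = i * (i + m) + m * i"
    by (simp add: n_def algebra_simps)
  from \<open>bij_betw ?F ?B ?C\<close> have "card ?C = card ?B" by (rule bij_betw_same_card[symmetric])
  also have "\<dots> = GL_order TYPE('a) i * (GL_order TYPE('a) m *
      (card (UNIV :: 'a set) ^ (i * (i + m)) * card (UNIV :: 'a set) ^ (m * i)))"
    by (simp add: card_cartesian_product GL_order_eq_card_det card_carrier_mat)
  finally show ?thesis
    unfolding exponent by (simp add: power_add mult_ac)
qed

section \<open>Counting square-zero matrices and involutory matrices\<close>

lemma square_zero_iff_similar_nf:
  fixes N :: "'a::field mat"
  assumes N: "N \<in> carrier_mat n n"
  shows "N * N = 0\<^sub>m n n \<longleftrightarrow> (\<exists>i. 2 * i \<le> n \<and> similar_mat N (square_zero_nf i (n - 2 * i)))"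
proof
  assume "N * N = 0\<^sub>m n n"
  then obtain i m where im: "n = i + (i + m)" "similar_mat N (square_zero_nf i m)"
    using square_zero_similar_nf[OF N] by blast
  then have "2 * i \<le> n" "m = n - 2 * i" by simp_all
  with im(2) show "\<exists>i. 2 * i \<le> n \<and> similar_mat N (square_zero_nf i (n - 2 * i))" by blast
next
  assume "\<exists>i. 2 * i \<le> n \<and> similar_mat N (square_zero_nf i (n - 2 * i))"
  then obtain i where i: "2 * i \<le> n" "similar_mat N (square_zero_nf i (n - 2 * i))" by blast
  let ?J = "square_zero_nf i (n - 2 * i) :: 'a mat"
  from i(1) have n: "i + (i + (n - 2 * i)) = n" by simp
  have J: "?J \<in> carrier_mat n n" using square_zero_nf_carrier[of i "n - 2 * i"] unfolding n .
  have JJ: "?J * ?J = 0\<^sub>m n n" using square_zero_nf_square[of i "n - 2 * i"] unfolding n .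
  obtain P Q where PQ: "P \<in> carrier_mat n n" "Q \<in> carrier_mat n n" "Q * P = 1\<^sub>m n" "N = P * ?J * Q"
    using i(2) N by (auto simp: similar_mat_def similar_mat_wit_def Let_def)
  have "N * N = P * (?J * ((Q * P) * (?J * Q)))"
    unfolding PQ(4) using PQ(1,2) J by (simp add: assoc_mult_mat[of _ n n _ n _ n])
  also have "\<dots> = P * ((?J * ?J) * Q)"
    unfolding PQ(3) using PQ(1,2) J by (simp add: assoc_mult_mat[of _ n n _ n _ n])
  also have "\<dots> = 0\<^sub>m n n" unfolding JJ using PQ(1,2) by simp
  finally show "N * N = 0\<^sub>m n n" .
qed

lemma card_square_zero:
  "card {N :: 'a::{field, finite} mat. N \<in> carrier_mat n n \<and> N * N = 0\<^sub>m n n} =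
    (\<Sum>i | 2 * i \<le> n. card {N :: 'a mat. N \<in> carrier_mat n n \<and> similar_mat N (square_zero_nf i (n - 2 * i))})"
proof -
  let ?O = "\<lambda>i. {N :: 'a mat. N \<in> carrier_mat n n \<and> similar_mat N (square_zero_nf i (n - 2 * i))}"
  have fin: "finite {i. 2 * i \<le> n}" by (rule finite_subset[of _ "{..n}"]) auto
  have "{N :: 'a mat. N \<in> carrier_mat n n \<and> N * N = 0\<^sub>m n n} = (\<Union>i\<in>{i. 2 * i \<le> n}. ?O i)"
    using square_zero_iff_similar_nf by blast
  also have "card \<dots> = (\<Sum>i | 2 * i \<le> n. card (?O i))"
  proof (rule card_UN_disjoint[OF fin])
    show "\<forall>i\<in>{i. 2 * i \<le> n}. finite (?O i)"
      by (intro ballI finite_subset[OF _ finite_carrier_mat[of n n]]) auto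
    show "\<forall>i\<in>{i. 2 * i \<le> n}. \<forall>j\<in>{i. 2 * i \<le> n}. i \<noteq> j \<longrightarrow> ?O i \<inter> ?O j = {}"
    proof (intro ballI impI, rule ccontr)
      fix i j assume ij: "i \<in> {i. 2 * i \<le> n}" "j \<in> {i. 2 * i \<le> n}" "i \<noteq> j" "?O i \<inter> ?O j \<noteq> {}"
      then obtain N where "similar_mat N (square_zero_nf i (n - 2 * i))"
        "similar_mat N (square_zero_nf j (n - 2 * j) :: 'a mat)" by blast
      then have sim: "similar_mat (square_zero_nf i (n - 2 * i)) (square_zero_nf j (n - 2 * j) :: 'a mat)"
        using similar_mat_sym similar_mat_trans by blast
      have n: "n = i + (i + (n - 2 * i))" "n = j + (j + (n - 2 * j))" using ij by simp_all
      have "j \<le> i" "i \<le> j"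
        using similar_square_zero_nf_le[OF n sim] similar_square_zero_nf_le[OF n(2,1) similar_mat_sym[OF sim]]
        by simp_all
      with ij(3) show False by simp
    qed
  qed
  finally show ?thesis .
qed

text \<open>
  Translation by \<open>1\<close> permutes the field, hence leaves the sum of all elements unchanged; so the
  number of elements vanishes in the field.
\<close>

lemma two_eq_zero_of_card:
  assumes "card (UNIV :: 'a::{field, finite} set) = 2 ^ k"
  shows "(2 :: 'a) = 0"
proof -
  have "(\<Sum>x\<in>(UNIV :: 'a set). x + 1) = (\<Sum>x\<in>UNIV. x)"
    by (rule sum.reindex_bij_witness[of _ "\<lambda>x. x - 1" "\<lambda>x. x + 1"]) auto
  then have "of_nat (card (UNIV :: 'a set)) = (0 :: 'a)" by (simp add: sum.distrib)
  then show ?thesis unfolding assms by simp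
qed

lemma square_add_one_char_two:
  fixes N :: "'a::field mat"
  assumes two: "(2 :: 'a) = 0" and N: "N \<in> carrier_mat n n"
  shows "(N + 1\<^sub>m n) * (N + 1\<^sub>m n) = N * N + 1\<^sub>m n"
proof -
  have xx: "x + x = 0" for x :: 'a using two by (metis mult_2 mult_zero_left)
  have NN: "N * N \<in> carrier_mat n n" using N by simp
  have "(N + 1\<^sub>m n) * (N + 1\<^sub>m n) = (N * N + N) + (N + 1\<^sub>m n)"
    using N by (simp add: add_mult_distrib_mat[of _ n n] mult_add_distrib_mat[of _ n n])
  also have "\<dots> = N * N + 1\<^sub>m n"
  proof (rule eq_matI)
    fix i j assume "i < dim_row (N * N + 1\<^sub>m n)" "j < dim_col (N * N + 1\<^sub>m n)"
    then have ij: "i < n" "j < n" by simp_all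
    then have "((N * N + N) + (N + 1\<^sub>m n)) $$ (i,j) =
        (N * N) $$ (i,j) + (N $$ (i,j) + N $$ (i,j)) + 1\<^sub>m n $$ (i,j)"
      using N by (simp del: index_mult_mat(1) add: add.assoc)
    then show "((N * N + N) + (N + 1\<^sub>m n)) $$ (i,j) = (N * N + 1\<^sub>m n) $$ (i,j)"
      unfolding xx using N ij by (simp del: index_mult_mat(1))
  qed (use N in simp_all)
  finally show ?thesis .
qed

lemma card_involutory_eq_card_square_zero:
  assumes two: "(2 :: 'a::field) = 0"
  shows "card {A :: 'a mat. A \<in> carrier_mat n n \<and> A ^\<^sub>m 2 = 1\<^sub>m n} =
    card {N :: 'a mat. N \<in> carrier_mat n n \<and> N * N = 0\<^sub>m n n}"
proof -
  have xx: "x + x = 0" for x :: 'a using two by (metis mult_2 mult_zero_left)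
  have II: "1\<^sub>m n + 1\<^sub>m n = (0\<^sub>m n n :: 'a mat)" by (rule eq_matI) (simp_all add: xx)
  have inv: "A + 1\<^sub>m n + 1\<^sub>m n = A" if "A \<in> carrier_mat n n" for A :: "'a mat"
    using that II by (simp add: assoc_add_mat[of _ n n])
  have sq: "A ^\<^sub>m 2 = A * A" if "A \<in> carrier_mat n n" for A :: "'a mat"
    using that by (simp add: numeral_2_eq_2)
  have "bij_betw (\<lambda>A. A + 1\<^sub>m n) {A :: 'a mat. A \<in> carrier_mat n n \<and> A ^\<^sub>m 2 = 1\<^sub>m n}
      {N. N \<in> carrier_mat n n \<and> N * N = 0\<^sub>m n n}"
    by (rule bij_betw_byWitness[where f' = "\<lambda>A. A + 1\<^sub>m n"])
      (auto simp: inv sq square_add_one_char_two[OF two] II)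
  then show ?thesis by (rule bij_betw_same_card)
qed

theorem theorem15:
  fixes q k n :: nat
  assumes "card (UNIV :: 'a::{field, finite} set) = q"
    and "q = 2 ^ k"
    and "n \<ge> 1"
  shows "real (card {A :: 'a mat. A \<in> carrier_mat n n \<and> A ^\<^sub>m 2 = 1\<^sub>m n}) =
    (\<Sum>i | 2 * i \<le> n.
       real (GL_order TYPE('a) n) /
         (real q ^ (i * (2 * n - 3 * i)) *
          real (GL_order TYPE('a) i) * real (GL_order TYPE('a) (n - 2 * i))))"
proof -
  let ?J = "\<lambda>i. square_zero_nf i (n - 2 * i) :: 'a mat"
  have GL_pos: "GL_order TYPE('a) j > 0" for j
  proof -
    have "1\<^sub>m j \<in> {P :: 'a mat. P \<in> carrier_mat j j \<and> det P \<noteq> 0}" by simp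
    moreover have "finite {P :: 'a mat. P \<in> carrier_mat j j \<and> det P \<noteq> 0}"
      by (rule finite_subset[OF _ finite_carrier_mat[of j j]]) auto
    ultimately show ?thesis unfolding GL_order_eq_card_det card_gt_0_iff by blast
  qed
  have q: "q > 0" using assms(2) by simp
  have orbit: "real (card {N \<in> carrier_mat n n. similar_mat N (?J i)}) =
      real (GL_order TYPE('a) n) / (real q ^ (i * (2 * n - 3 * i)) *
          real (GL_order TYPE('a) i) * real (GL_order TYPE('a) (n - 2 * i)))"
    if "2 * i \<le> n" for i
  proof -
    from that have n: "i + (i + (n - 2 * i)) = n" by simp
    have J: "?J i \<in> carrier_mat n n" using square_zero_nf_carrier[of i "n - 2 * i"] unfolding n .
    have "card {N \<in> carrier_mat n n. similar_mat N (?J i)} *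
        (q ^ (i * (2 * n - 3 * i)) * GL_order TYPE('a) i * GL_order TYPE('a) (n - 2 * i)) =
        GL_order TYPE('a) n"
      using card_similarity_class[OF J] card_centralizer_square_zero_nf[of i "n - 2 * i", where 'a = 'a]
      unfolding n assms(1) by simp
    from arg_cong[OF this, of real] show ?thesis
      using q GL_pos[of i] GL_pos[of "n - 2 * i"] by (simp add: field_simps)
  qed
  have two: "(2 :: 'a) = 0" using two_eq_zero_of_card assms(1,2) by metis
  show ?thesis
    unfolding card_involutory_eq_card_square_zero[OF two] card_square_zero of_nat_sum
    by (rule sum.cong) (use orbit in auto)
qed

end
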